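(* Let $D$ be a commutative ring, let $I$ be an integrally closed ideal of $D$, and set $R:=D/I$. Let $n\in\mathbb{N}$ and let $A$ be a principled $n\times n$-matrix over $R$. Then $A$ is nullcyclic.
   Context: All rings are commutative, associative and unital; $\mathbb{N}=\{0,1,2,\ldots\}$ and $[n]:=\{1,2,\ldots,n\}$. Let $A=(a_{i,j})_{i,j\in[n]}$ be a matrix over a ring $R$. For $S\subseteq[n]$, $A_S$ denotes the principal submatrix of $A$ with row and column set $S$; the empty determinant is $1$. $A$ is principled if $\det A_S=\prod_{i\in S}a_{i,i}$ for every $S\subseteq[n]$. A cycle on $[n]$ is a $k$-tuple $C=(i_1,i_2,\ldots,i_k)$ with $k>0$ and $i_1,\ldots,i_k$ distinct elements of $[n]$, considered up to cyclic rotation; it is nontrivial if $k>1$. The $A$-weight of a cycle $C=(i_1,\ldots,i_k)$ is $w_A(C):=a_{i_1,i_2}a_{i_2,i_3}\cdots a_{i_{k-1},i_k}a_{i_k,i_1}$. $A$ is nullcyclic if $w_A(C)=0$ for each nontrivial cycle $C$ on $[n]$. For an ideal $I$ of a commutative ring $D$, an element $x\in D$ is integral over $I$ if there exist a positive integer $d$ and elements $c_j\in I^j$ for all $j\in[d]$ such that $x^d+c_1x^{d-1}+c_2x^{d-2}+\cdots+c_d=0$. The integral closure $\overline{I}$ is the set of all elements of $D$ integral over $I$, and $I$ is integrally closed if $\overline{I}=I$. *)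

theory Defs
  imports
    "HOL-Algebra.QuotRing"
    "HOL-Algebra.Ideal_Product"
    "HOL-Combinatorics.Permutations"
begin

text \<open>
  Ideal powers are taken in the monoid \<open>ideals_set D\<close>, whose product is the ideal product
  and whose unit is \<open>carrier D\<close>, so \<open>I [^]\<^bsub>ideals_set D\<^esub> j\<close> is the usual power of \<open>I\<close>.
\<close>

definition integral_over :: "('a, 'b) ring_scheme \<Rightarrow> 'a set \<Rightarrow> 'a \<Rightarrow> bool"
  where "integral_over D I x \<longleftrightarrow>
    (\<exists>d::nat. \<exists>c::nat \<Rightarrow> 'a.
      d > 0 \<and>
      (\<forall>j\<in>{1..d}. c j \<in> I [^]\<^bsub>ideals_set D\<^esub> j) \<and>
      x [^]\<^bsub>D\<^esub> d \<oplus>\<^bsub>D\<^esub> (\<Oplus>\<^bsub>D\<^esub>j\<in>{1..d}. c j \<otimes>\<^bsub>D\<^esub> x [^]\<^bsub>D\<^esub> (d - j)) = \<zero>\<^bsub>D\<^esub>)"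

definition integral_closure :: "('a, 'b) ring_scheme \<Rightarrow> 'a set \<Rightarrow> 'a set"
  where "integral_closure D I = {x \<in> carrier D. integral_over D I x}"

definition integrally_closed :: "('a, 'b) ring_scheme \<Rightarrow> 'a set \<Rightarrow> bool"
  where "integrally_closed D I \<longleftrightarrow> integral_closure D I = I"

text \<open>
  An $n \times n$ matrix is a function of two indices from \<open>{1..n}\<close>; its values at other
  arguments are irrelevant.
\<close>

definition matrix_over :: "('a, 'b) ring_scheme \<Rightarrow> nat \<Rightarrow> (nat \<Rightarrow> nat \<Rightarrow> 'a) \<Rightarrow> bool"
  where "matrix_over R n A \<longleftrightarrow> (\<forall>i\<in>{1..n}. \<forall>j\<in>{1..n}. A i j \<in> carrier R)"

text \<open>
  The library determinants need a type of class \<open>comm_ring_1\<close>, which a quotient \<open>D Quot I\<close> by a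
  variable ideal is not. The Leibniz formula, with rows and columns indexed by \<open>S\<close>
  itself, gives the determinant of the principal submatrix $A_S$.
\<close>

definition principal_minor :: "('a, 'b) ring_scheme \<Rightarrow> (nat \<Rightarrow> nat \<Rightarrow> 'a) \<Rightarrow> nat set \<Rightarrow> 'a"
  where "principal_minor R A S =
    (\<Oplus>\<^bsub>R\<^esub>p\<in>{p. p permutes S}. add_pow R (sign p) (\<Otimes>\<^bsub>R\<^esub>i\<in>S. A i (p i)))"

definition principled :: "('a, 'b) ring_scheme \<Rightarrow> nat \<Rightarrow> (nat \<Rightarrow> nat \<Rightarrow> 'a) \<Rightarrow> bool"
  where "principled R n A \<longleftrightarrow>
    (\<forall>S. S \<subseteq> {1..n} \<longrightarrow> principal_minor R A S = (\<Otimes>\<^bsub>R\<^esub>i\<in>S. A i i))"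

text \<open>
  A cycle is represented by a tuple. Tuples that differ by a cyclic rotation represent the same
  cycle; they have the same weight (lemma \<open>cycle_weight_rotate\<close>), so a
  statement about the weights of all cycles may quantify over all representatives.
\<close>

definition is_cycle :: "nat \<Rightarrow> nat list \<Rightarrow> bool"
  where "is_cycle n C \<longleftrightarrow> length C > 0 \<and> distinct C \<and> set C \<subseteq> {1..n}"

definition nontrivial_cycle :: "nat \<Rightarrow> nat list \<Rightarrow> bool"
  where "nontrivial_cycle n C \<longleftrightarrow> is_cycle n C \<and> length C > 1"

definition cycle_weight :: "('a, 'b) ring_scheme \<Rightarrow> (nat \<Rightarrow> nat \<Rightarrow> 'a) \<Rightarrow> nat list \<Rightarrow> 'a"
  where "cycle_weight R A C =
    (\<Otimes>\<^bsub>R\<^esub>j\<in>{..<length C}. A (C ! j) (C ! (Suc j mod length C)))"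

definition nullcyclic :: "('a, 'b) ring_scheme \<Rightarrow> nat \<Rightarrow> (nat \<Rightarrow> nat \<Rightarrow> 'a) \<Rightarrow> bool"
  where "nullcyclic R n A \<longleftrightarrow> (\<forall>C. nontrivial_cycle n C \<longrightarrow> cycle_weight R A C = \<zero>\<^bsub>R\<^esub>)"

lemma is_cycle_rotate: "is_cycle n (rotate m C) \<longleftrightarrow> is_cycle n C"
  by (simp add: is_cycle_def)

lemma (in cring) principal_minor_empty: "principal_minor R A {} = \<one>"
proof -
  have "add_pow R (1::int) \<one> = \<one>"
    using add.int_pow_1[of \<one>] by simp
  then show ?thesis
    by (simp add: principal_minor_def)
qed

lemma (in cring) cycle_weight_rotate:
  assumes "matrix_over R n A" and "is_cycle n C"
  shows "cycle_weight R A (rotate m C) = cycle_weight R A C"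
proof -
  define k where "k = length C"
  have k: "k > 0" using assms(2) by (simp add: is_cycle_def k_def)
  define f where "f = (\<lambda>j. A (C ! j) (C ! (Suc j mod k)))"
  define h where "h = (\<lambda>j. (m + j) mod k)"
  have entry: "C ! j \<in> {1..n}" if "j < k" for j
    using assms(2) that nth_mem unfolding is_cycle_def k_def by blast
  have f: "f j \<in> carrier R" if "j < k" for j
    using assms(1) entry[OF that] entry[of "Suc j mod k"] k
    by (simp add: matrix_over_def f_def)
  have le: "x = y" if "x \<le> y" "y < k" "h x = h y" for x y
  proof -
    have "k dvd (m + y) - (m + x)"
      using that by (intro mod_eq_dvd_iff_nat[THEN iffD1]) (auto simp: h_def)
    then have "k dvd y - x" by simp
    then show ?thesis using that by (auto dest: dvd_imp_le)
  qed
  have inj: "inj_on h {..<k}"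
    by (rule inj_onI) (metis le lessThan_iff nat_le_linear)
  have im: "h ` {..<k} = {..<k}"
    by (rule endo_inj_surj) (use inj k in \<open>auto simp: h_def\<close>)
  have "cycle_weight R A (rotate m C) = (\<Otimes>j\<in>{..<k}. f (h j))"
    unfolding cycle_weight_def
  proof (rule finprod_cong')
    fix j assume j: "j \<in> {..<k}"
    have "Suc j mod k < k" using k by simp
    then show "A (rotate m C ! j) (rotate m C ! (Suc j mod length (rotate m C))) = f (h j)"
      using j by (simp add: nth_rotate f_def h_def k_def[symmetric] mod_simps)
  qed (use f k in \<open>auto simp: h_def k_def\<close>)
  also have "\<dots> = (\<Otimes>j\<in>h ` {..<k}. f j)"
    using finprod_reindex[of f h "{..<k}"] inj f im by auto
  also have "\<dots> = cycle_weight R A C"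
    by (simp only: im) (simp add: cycle_weight_def f_def k_def)
  finally show ?thesis .
qed

end

theory Submission
  imports Defs "HOL-Combinatorics.Cycles"
begin

text \<open>
  Lift \<open>A\<close> to a matrix \<open>a\<close> over \<open>D\<close>. The claim becomes: if every principal minor of \<open>a\<close> is congruent
  modulo \<open>I\<close> to the product of its diagonal, then the weight of every cycle of length at least 2
  lies in \<open>I\<close>. The proof is by strong induction on the length of the cycle.

  Let \<open>S\<close> be the vertex set of a cycle, and let the induction hypothesis settle all shorter cycles
  inside \<open>S\<close>. For a permutation \<open>p\<close> of \<open>S\<close> write \<open>W p\<close> for its term in the Leibniz formula, without
  the sign. The diagonal product is \<open>W id\<close>, so the signed sum of the \<open>W p\<close> over all \<open>p \<noteq> id\<close> lies in
  \<open>I\<close>. A permutation \<open>p \<noteq> id\<close> that is not a single cycle through all of \<open>S\<close> contains a shorter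
  nontrivial cycle, so \<open>W p \<in> I\<close>. The heart of the matter is the case of two different
  permutations \<open>p\<close> and \<open>q\<close> that both are full cycles: then \<open>W p * W q\<close> lies in \<open>I\<^sup>2\<close>
  (lemma \<open>spanning_cycles_product\<close>). Indeed, choose \<open>u\<close> with \<open>p u \<noteq> q u\<close>. The arc from \<open>u\<close> to \<open>p u\<close>,
  followed by the path of \<open>q\<close> back to \<open>u\<close>, is a cycle that misses \<open>q u\<close>; the arc from \<open>u\<close> to \<open>q u\<close>,
  followed by the path of \<open>p\<close> back to \<open>u\<close>, is a cycle that misses \<open>p u\<close>. Neither uses an arc that
  the other takes from the same permutation, so \<open>W p * W q\<close> is a multiple of the product of
  the weights of two shorter cycles.

  Now fix a full cycle \<open>q\<close> and let \<open>s\<close> be the signed sum of the \<open>W p\<close> over all full cycles \<open>p\<close>.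
  Then \<open>s \<in> I\<close>, and multiplying \<open>s\<close> by the signed term \<open>x\<close> of \<open>q\<close> gives \<open>x\<^sup>2 - s x + t = 0\<close> with
  \<open>t \<in> I\<^sup>2\<close>. So \<open>x\<close> is integral over \<open>I\<close>, and therefore lies in \<open>I\<close>
  (lemma \<open>summand_in_integrally_closed_ideal\<close>).
\<close>

section \<open>Permutations, closed walks and shortcuts\<close>

definition perm_weight :: "('a, 'b) ring_scheme \<Rightarrow> ('v \<Rightarrow> 'v \<Rightarrow> 'a) \<Rightarrow> 'v set \<Rightarrow> ('v \<Rightarrow> 'v) \<Rightarrow> 'a"
  where "perm_weight R a S p = (\<Otimes>\<^bsub>R\<^esub>i\<in>S. a i (p i))"

definition walk_weight :: "('a, 'b) ring_scheme \<Rightarrow> ('v \<Rightarrow> 'v \<Rightarrow> 'a) \<Rightarrow> (nat \<Rightarrow> 'v) \<Rightarrow> nat \<Rightarrow> 'a"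
  where "walk_weight R a x m = (\<Otimes>\<^bsub>R\<^esub>i\<in>{..<m}. a (x i) (x (Suc i)))"

text \<open>
  A cycle is a sequence that returns to its start after \<open>m\<close> steps; the repeated end point
  \<open>x m = x 0\<close> allows arcs to be counted without index arithmetic modulo \<open>m\<close>. Values beyond \<open>m\<close> are
  arbitrary, so orbits \<open>\<lambda>i. (p ^^ i) u\<close> qualify as they stand. Cycles of length 1 are excluded, since
  they have no reason to have weight in the ideal.
\<close>

definition simple_cycle :: "'v set \<Rightarrow> (nat \<Rightarrow> 'v) \<Rightarrow> nat \<Rightarrow> bool"
  where "simple_cycle S x m \<longleftrightarrow>
    2 \<le> m \<and> inj_on x {..<m} \<and> x ` {..<m} \<subseteq> S \<and> x m = x 0"

text \<open>
  Jump from the start directly to position \<open>j\<close>, then continue as before: \<open>x 0, x j, x (j + 1), \<dots>\<close>.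
\<close>

definition shortcut :: "(nat \<Rightarrow> 'v) \<Rightarrow> nat \<Rightarrow> nat \<Rightarrow> 'v"
  where "shortcut x j = (\<lambda>i. if i = 0 then x 0 else x (i + j - 1))"

section \<open>Integral dependence\<close>

lemma (in cring) ideal_pow_1:
  assumes "ideal I R"
  shows "I [^]\<^bsub>ideals_set R\<^esub> (1::nat) = I"
proof -
  have "I [^]\<^bsub>ideals_set R\<^esub> (1::nat) = ideal_prod R (carrier R) I"
    by (simp add: nat_pow_def ideals_set_def)
  also have "\<dots> = I"
  proof
    show "ideal_prod R (carrier R) I \<subseteq> I"
      using ideal_prod_inter[OF oneideal assms] by simp
    show "I \<subseteq> ideal_prod R (carrier R) I"
      using ideal_prod.prod[of \<one> "carrier R" _ I R] ideal.Icarr[OF assms] by fastforce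
  qed
  finally show ?thesis .
qed

lemma (in cring) ideal_pow_2:
  assumes "ideal I R"
  shows "I [^]\<^bsub>ideals_set R\<^esub> (2::nat) = ideal_prod R I I"
proof -
  have "I [^]\<^bsub>ideals_set R\<^esub> (2::nat) = ideal_prod R (I [^]\<^bsub>ideals_set R\<^esub> (1::nat)) I"
    by (simp add: nat_pow_def ideals_set_def numeral_2_eq_2)
  then show ?thesis using ideal_pow_1[OF assms] by simp
qed

text \<open>Quadratic equations of integral dependence are the only ones that the proof uses.\<close>

lemma (in cring) integral_over_quadratic:
  assumes I: "ideal I R" and x: "x \<in> carrier R" and s: "s \<in> I" and t: "t \<in> ideal_prod R I I"
    and eq: "x \<otimes> x \<oplus> (s \<otimes> x \<oplus> t) = \<zero>"
  shows "integral_over R I x"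
proof -
  define c where "c = (\<lambda>j::nat. if j = 1 then s else t)"
  have car: "s \<in> carrier R" "t \<in> carrier R"
    using ideal.Icarr[OF I s] ideal_prod_in_carrier[OF I I] t by auto
  have set: "{1..2::nat} = {1,2}" by auto
  have "(\<Oplus>j\<in>{1..2::nat}. c j \<otimes> x [^] (2 - j)) = s \<otimes> x \<oplus> t"
    unfolding set using x car by (subst finsum_insert) (auto simp: c_def)
  moreover have "x [^] (2::nat) = x \<otimes> x"
    using x by (simp add: numeral_2_eq_2)
  moreover have "\<forall>j\<in>{1..2}. c j \<in> I [^]\<^bsub>ideals_set R\<^esub> j"
    unfolding set using s t ideal_pow_1[OF I] ideal_pow_2[OF I] by (simp add: c_def)
  ultimately show ?thesis
    unfolding integral_over_def using eq by (intro exI[of _ "2::nat"] exI[of _ c]) simp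
qed

lemma (in cring) finsum_in_ideal:
  assumes "ideal J R" and "\<And>p. p \<in> G \<Longrightarrow> f p \<in> J"
  shows "(\<Oplus>p\<in>G. f p) \<in> J"
proof -
  interpret J: ideal J R by fact
  show ?thesis using assms(2)
  proof (induction G rule: infinite_finite_induct)
    case (insert p G)
    then have "f \<in> G \<rightarrow> carrier R" "f p \<in> carrier R" by (auto intro: J.Icarr)
    with insert show ?case by (simp add: finsum_insert J.a_closed)
  qed (simp_all add: finsum_infinite)
qed

text \<open>
  Write \<open>x\<close> for the summand \<open>v q\<close> and \<open>g\<close> for the sum of the other summands outside \<open>I\<close>. Removing the
  summands in \<open>I\<close> from the total shows \<open>x + g \<in> I\<close>, and \<open>g x \<in> I\<^sup>2\<close> by orthogonality, so
  \<open>x\<^sup>2 - (x + g) x + g x = 0\<close> is an equation of integral dependence of \<open>x\<close> over \<open>I\<close>.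
\<close>

lemma (in cring) summand_in_integrally_closed_ideal:
  assumes I: "ideal I R" and closed: "integrally_closed R I"
    and P: "finite P" and q: "q \<in> P" and v: "\<And>p. p \<in> P \<Longrightarrow> v p \<in> carrier R"
    and sum: "(\<Oplus>p\<in>P. v p) \<in> I"
    and others: "\<And>p. p \<in> P \<Longrightarrow> p \<noteq> q \<Longrightarrow> v p \<in> I \<or> v p \<otimes> v q \<in> ideal_prod R I I"
  shows "v q \<in> I"
proof -
  interpret I: ideal I R by fact
  define G where "G = {p \<in> P. p \<noteq> q \<and> v p \<notin> I}"
  define B where "B = {p \<in> P. p \<noteq> q \<and> v p \<in> I}"
  define g where "g = (\<Oplus>p\<in>G. v p)"
  define b where "b = (\<Oplus>p\<in>B. v p)"
  have fin: "finite G" "finite B" using P by (auto simp: G_def B_def)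
  have car: "v \<in> G \<rightarrow> carrier R" "v \<in> B \<rightarrow> carrier R" "v q \<in> carrier R"
    using v q by (auto simp: G_def B_def)
  have gb: "g \<in> carrier R" "b \<in> carrier R"
    using car by (auto simp: g_def b_def intro!: finsum_closed)
  have bI: "b \<in> I"
    unfolding b_def by (rule finsum_in_ideal[OF I]) (simp add: B_def)
  have Un: "P = insert q (G \<union> B)" using q by (auto simp: G_def B_def)
  have "(\<Oplus>p\<in>P. v p) = v q \<oplus> (\<Oplus>p\<in>G \<union> B. v p)"
    unfolding Un using fin car by (subst finsum_insert) (auto simp: G_def B_def)
  also have "(\<Oplus>p\<in>G \<union> B. v p) = g \<oplus> b"
    unfolding g_def b_def using fin car by (intro finsum_Un_disjoint) (auto simp: G_def B_def)
  finally have "(v q \<oplus> g \<oplus> b) \<in> I" using sum car gb by (simp add: a_assoc)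
  then have "(v q \<oplus> g \<oplus> b) \<oplus> \<ominus> b \<in> I"
    using bI by (blast intro: I.a_closed I.a_inv_closed)
  then have sI: "v q \<oplus> g \<in> I" using car gb by (simp add: a_assoc r_neg)
  have t: "g \<otimes> v q \<in> ideal_prod R I I"
  proof -
    have "g \<otimes> v q = (\<Oplus>p\<in>G. v p \<otimes> v q)"
      unfolding g_def using fin car by (intro finsum_ldistr) auto
    also have "\<dots> \<in> ideal_prod R I I"
      by (rule finsum_in_ideal[OF ideal_prod_is_ideal[OF I I]]) (use others in \<open>auto simp: G_def\<close>)
    finally show ?thesis .
  qed
  have "v q \<otimes> v q \<oplus> (\<ominus> (v q \<oplus> g) \<otimes> v q \<oplus> g \<otimes> v q) = \<zero>"
    using car gb by algebra
  then have "integral_over R I (v q)"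
    using integral_over_quadratic[OF I car(3) I.a_inv_closed[OF sI] t] by blast
  then have "v q \<in> integral_closure R I"
    using car by (simp add: integral_closure_def)
  then show ?thesis using closed by (simp add: integrally_closed_def)
qed

section \<open>Weights of cycles\<close>

lemma simple_cycle_image:
  assumes "finite S" and "simple_cycle S x (card S)"
  shows "x ` {..<card S} = S"
  using assms card_subset_eq[of S "x ` {..<card S}"] by (simp add: simple_cycle_def card_image)

lemma (in cring) walk_weight_closed:
  assumes "\<And>i j. a i j \<in> carrier R"
  shows "walk_weight R a x m \<in> carrier R"
  using assms by (auto simp: walk_weight_def intro!: finprod_closed)

lemma (in cring) perm_weight_closed:
  assumes "\<And>i j. a i j \<in> carrier R"
  shows "perm_weight R a S p \<in> carrier R"
  using assms by (auto simp: perm_weight_def intro!: finprod_closed)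

lemma simple_cycle_shortcut:
  assumes "simple_cycle S x m" and "2 \<le> j" and "j < m"
  shows "simple_cycle S (shortcut x j) (Suc (m - j))"
  unfolding simple_cycle_def
proof (intro conjI)
  have inj: "inj_on x {..<m}" and im: "x ` {..<m} \<subseteq> S" and close: "x m = x 0"
    using assms(1) by (auto simp: simple_cycle_def)
  have eq: "shortcut x j i = x (if i = 0 then 0 else i + j - 1)" for i
    by (simp add: shortcut_def)
  show "inj_on (shortcut x j) {..<Suc (m - j)}"
  proof (rule inj_onI)
    fix i k assume i: "i \<in> {..<Suc (m - j)}" and k: "k \<in> {..<Suc (m - j)}"
      and "shortcut x j i = shortcut x j k"
    then have "(if i = 0 then 0 else i + j - 1) = (if k = 0 then 0 else k + j - 1)"
      using assms by (intro inj_onD[OF inj]) (auto simp: eq)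
    then show "i = k" using assms by (auto split: if_splits)
  qed
  show "shortcut x j ` {..<Suc (m - j)} \<subseteq> S"
    using assms im by (auto simp: eq)
  show "2 \<le> Suc (m - j)" "shortcut x j (Suc (m - j)) = shortcut x j 0"
    using assms close by (auto simp: shortcut_def)
qed

text \<open>
  The factor \<open>s\<close>, the weight of the path from \<open>x j\<close> to the end, is common to a closed walk and its
  shortcut; the two differ in how they get from \<open>x 0\<close> to \<open>x j\<close>.
\<close>

lemma (in cring) walk_weight_shortcut:
  assumes a: "\<And>i j. a i j \<in> carrier R" and "2 \<le> j" and "j < m"
  obtains r s where "r \<in> carrier R" "s \<in> carrier R"
    "walk_weight R a x m = a (x 0) (x 1) \<otimes> r \<otimes> s"
    "walk_weight R a (shortcut x j) (Suc (m - j)) = a (x 0) (x j) \<otimes> s"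
proof -
  let ?f = "\<lambda>i. a (x i) (x (Suc i))"
  let ?g = "\<lambda>i. a (shortcut x j i) (shortcut x j (Suc i))"
  define r where "r = (\<Otimes>i\<in>{1..<j}. ?f i)"
  define s where "s = (\<Otimes>i\<in>{j..<m}. ?f i)"
  have car: "r \<in> carrier R" "s \<in> carrier R"
    using a by (auto simp: r_def s_def intro!: finprod_closed)
  have "{..<m} = insert 0 ({1..<j} \<union> {j..<m})" using assms by auto
  then have "walk_weight R a x m = ?f 0 \<otimes> (\<Otimes>i\<in>{1..<j} \<union> {j..<m}. ?f i)"
    unfolding walk_weight_def using a assms by (simp only:) (subst finprod_insert, auto)
  also have "(\<Otimes>i\<in>{1..<j} \<union> {j..<m}. ?f i) = r \<otimes> s"
    unfolding r_def s_def using a by (intro finprod_Un_disjoint) auto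
  finally have 1: "walk_weight R a x m = a (x 0) (x 1) \<otimes> r \<otimes> s"
    using a car by (simp add: m_assoc)
  have "{..<Suc (m - j)} = insert 0 (Suc ` {..<m - j})" by (rule lessThan_Suc_eq_insert_0)
  then have "walk_weight R a (shortcut x j) (Suc (m - j)) = ?g 0 \<otimes> (\<Otimes>i\<in>Suc ` {..<m - j}. ?g i)"
    unfolding walk_weight_def using a by (simp only:) (subst finprod_insert, auto)
  also have "(\<Otimes>i\<in>Suc ` {..<m - j}. ?g i) = (\<Otimes>i\<in>{..<m - j}. ?g (Suc i))"
    using a by (intro finprod_reindex) auto
  also have "\<dots> = (\<Otimes>i\<in>{..<m - j}. ?f (i + j))"
    using a by (intro finprod_cong') (auto simp: shortcut_def)
  also have "\<dots> = (\<Otimes>i\<in>(\<lambda>i. i + j) ` {..<m - j}. ?f i)"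
    using a by (intro finprod_reindex[symmetric]) (auto intro: inj_onI)
  also have "(\<lambda>i. i + j) ` {..<m - j} = {j..<m}"
    using assms image_add_atLeastLessThan'[of j 0 "m - j"] by (simp add: atLeast0LessThan)
  finally have 2: "walk_weight R a (shortcut x j) (Suc (m - j)) = a (x 0) (x j) \<otimes> s"
    by (simp add: s_def shortcut_def)
  show ?thesis using that[OF car 1 2] .
qed

text \<open>
  Two cycles through all of \<open>S\<close> that leave their common start by different arcs can trade these
  arcs: the first arc of each shortcuts the other. Both shortcuts are strictly shorter, because
  each skips at least one vertex, and their arcs are among those of the two given cycles. So the
  product of the two weights is a multiple of a product of two elements of \<open>I\<close>.
\<close>

lemma (in cring) spanning_cycles_product:
  assumes I: "ideal I R" and a: "\<And>i j. a i j \<in> carrier R" and S: "finite S"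
    and y: "simple_cycle S y (card S)" and z: "simple_cycle S z (card S)"
    and start: "y 0 = z 0" and differ: "y 1 \<noteq> z 1"
    and IH: "\<And>x l. simple_cycle S x l \<Longrightarrow> l < card S \<Longrightarrow> walk_weight R a x l \<in> I"
  shows "walk_weight R a y (card S) \<otimes> walk_weight R a z (card S) \<in> ideal_prod R I I"
proof -
  let ?m = "card S"
  have m: "2 \<le> ?m" using y by (simp add: simple_cycle_def)
  \<comment> \<open>Since the starts agree and the first arcs differ, \<open>w 1\<close> cannot be \<open>x 0\<close> or \<open>x 1\<close>: the jump to it
      really skips something.\<close>
  have position: "\<exists>j. 2 \<le> j \<and> j < ?m \<and> x j = w 1"
    if x: "simple_cycle S x ?m" and w: "simple_cycle S w ?m" and "x 0 = w 0" "x 1 \<noteq> w 1" for x w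
  proof -
    have "w 1 \<in> S" using w m by (auto simp: simple_cycle_def)
    then obtain j where j: "j < ?m" "x j = w 1"
      using simple_cycle_image[OF S x] by (metis imageE lessThan_iff)
    have "w 1 \<noteq> w 0"
      using w m inj_onD[of w "{..<?m}" 1 0] by (auto simp: simple_cycle_def)
    then have "j \<noteq> 0" "j \<noteq> 1" using j that by metis+
    then have "2 \<le> j" by linarith
    then show ?thesis using j by blast
  qed
  obtain j where j: "2 \<le> j" "j < ?m" "y j = z 1" using position[OF y z start differ] by auto
  obtain k where k: "2 \<le> k" "k < ?m" "z k = y 1"
    using position[OF z y start[symmetric] differ[symmetric]] by auto
  obtain r s where rs: "r \<in> carrier R" "s \<in> carrier R"
    "walk_weight R a y ?m = a (y 0) (y 1) \<otimes> r \<otimes> s"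
    "walk_weight R a (shortcut y j) (Suc (?m - j)) = a (y 0) (y j) \<otimes> s"
    by (rule walk_weight_shortcut[where a = a and x = y, OF a j(1,2)])
  obtain r' s' where rs': "r' \<in> carrier R" "s' \<in> carrier R"
    "walk_weight R a z ?m = a (z 0) (z 1) \<otimes> r' \<otimes> s'"
    "walk_weight R a (shortcut z k) (Suc (?m - k)) = a (z 0) (z k) \<otimes> s'"
    by (rule walk_weight_shortcut[where a = a and x = z, OF a k(1,2)])
  have "a (y 0) (y j) \<otimes> s \<in> I" "a (z 0) (z k) \<otimes> s' \<in> I"
    using IH[OF simple_cycle_shortcut[OF y j(1,2)]] IH[OF simple_cycle_shortcut[OF z k(1,2)]]
      j(1,2) k(1,2) rs(4) rs'(4) by simp_all
  then have prod: "(a (y 0) (y j) \<otimes> s) \<otimes> (a (z 0) (z k) \<otimes> s') \<in> ideal_prod R I I"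
    by (rule ideal_prod.prod)
  have "walk_weight R a y ?m \<otimes> walk_weight R a z ?m
      = (r \<otimes> r') \<otimes> ((a (y 0) (y j) \<otimes> s) \<otimes> (a (z 0) (z k) \<otimes> s'))"
  proof -
    have 1: "a (z 0) (z 1) \<in> carrier R" "a (z 0) (y 1) \<in> carrier R" using a by auto
    show ?thesis
      unfolding rs(3) rs'(3) j(3) k(3) start using rs(1,2) rs'(1,2) 1 by algebra
  qed
  then show ?thesis
    using ideal.I_l_closed[OF ideal_prod_is_ideal[OF I I] prod] rs rs' by simp
qed

section \<open>Cycles and permutations\<close>

text \<open>
  Sending each vertex to its successor is onto \<open>S\<close>, hence bijective by finiteness; the start is
  reached because the cycle closes.
\<close>

lemma simple_cycle_permutation:
  assumes x: "simple_cycle S x m" and S: "S = x ` {..<m}"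
  obtains q where "q permutes S" "\<And>i. i < m \<Longrightarrow> q (x i) = x (Suc i)"
proof -
  have m: "2 \<le> m" and inj: "inj_on x {..<m}" and close: "x m = x 0"
    using x by (auto simp: simple_cycle_def)
  define q where "q v = (if v \<in> S then x (Suc (inv_into {..<m} x v)) else v)" for v
  have q: "q (x i) = x (Suc i)" if "i < m" for i
    using that inj by (simp add: q_def S inv_into_f_f)
  have "S \<subseteq> q ` S"
  proof
    fix v assume "v \<in> S"
    then obtain i where i: "i < m" "v = x i" by (auto simp: S)
    show "v \<in> q ` S"
    proof (cases i)
      case 0
      then have "v = q (x (m - 1))" using i m close q[of "m - 1"] by simp
      then show ?thesis using m by (auto simp: S)
    next
      case (Suc k)
      then have "v = q (x k)" using i q[of k] by simp
      then show ?thesis using i Suc by (auto simp: S)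
    qed
  qed
  moreover have "q ` S \<subseteq> S"
  proof
    fix v assume "v \<in> q ` S"
    then obtain i where i: "i < m" "v = x (Suc i)" using q by (auto simp: S)
    show "v \<in> S"
    proof (cases "Suc i = m")
      case True then show ?thesis using i m close by (auto simp: S)
    next
      case False then show ?thesis using i by (auto simp: S)
    qed
  qed
  ultimately have im: "q ` S = S" by blast
  moreover have "finite S" by (simp add: S)
  ultimately have "bij_betw q S S"
    by (simp add: bij_betw_def eq_card_imp_inj_on)
  then have "q permutes S"
    by (rule bij_imp_permutes) (simp add: q_def)
  then show ?thesis using that q by blast
qed

lemma (in cring) perm_weight_of_simple_cycle:
  assumes "\<And>i j. a i j \<in> carrier R" and "inj_on x {..<m}"
    and "\<And>i. i < m \<Longrightarrow> q (x i) = x (Suc i)"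
  shows "perm_weight R a (x ` {..<m}) q = walk_weight R a x m"
proof -
  have "perm_weight R a (x ` {..<m}) q = (\<Otimes>i\<in>{..<m}. a (x i) (q (x i)))"
    unfolding perm_weight_def using assms by (intro finprod_reindex) auto
  also have "\<dots> = walk_weight R a x m"
    unfolding walk_weight_def using assms by (intro finprod_cong') auto
  finally show ?thesis .
qed

lemma orbit_simple_cycle:
  assumes S: "finite S" and p: "p permutes S" and u: "u \<in> S" and moved: "p u \<noteq> u"
  shows "simple_cycle S (\<lambda>i. (p ^^ i) u) (least_power p u)"
proof -
  have perm: "permutation p" using S p by (auto simp: permutation_permutes)
  have "inj_on (\<lambda>i. (p ^^ i) u) {..<least_power p u}"
    using cycle_of_permutation[OF perm, of u] by (simp add: distinct_map atLeast_upt)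
  moreover have "(p ^^ i) u \<in> S" for i
    using u p by (induction i) (auto simp: permutes_in_image)
  ultimately show ?thesis
    using least_power_gt_one[OF perm moved] least_power_of_permutation(1)[OF perm, of u]
    by (auto simp: simple_cycle_def)
qed

text \<open>
  The orbit of a moved point is a cycle whose weight divides the weight of \<open>p\<close>. If the latter is
  not in \<open>I\<close>, the induction hypothesis forces this orbit to fill \<open>S\<close>. Then no point of \<open>S\<close> is
  fixed, so the orbit may be started at any \<open>u \<in> S\<close>; the freedom in \<open>u\<close> is what lets two
  permutations be compared at a point where they differ.
\<close>

lemma (in cring) perm_weight_in_ideal_or_spanning:
  assumes I: "ideal I R" and a: "\<And>i j. a i j \<in> carrier R" and S: "finite S"
    and p: "p permutes S" and nontrivial: "p \<noteq> id"
    and IH: "\<And>x l. simple_cycle S x l \<Longrightarrow> l < card S \<Longrightarrow> walk_weight R a x l \<in> I"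
    and notin: "perm_weight R a S p \<notin> I" and u: "u \<in> S"
  shows "simple_cycle S (\<lambda>i. (p ^^ i) u) (card S)"
    and "perm_weight R a S p = walk_weight R a (\<lambda>i. (p ^^ i) u) (card S)"
proof -
  interpret I: ideal I R by fact
  have spanning: "simple_cycle S (\<lambda>i. (p ^^ i) v) (card S) \<and>
      perm_weight R a S p = walk_weight R a (\<lambda>i. (p ^^ i) v) (card S)"
    if v: "v \<in> S" "p v \<noteq> v" for v
  proof -
    define x where "x = (\<lambda>i. (p ^^ i) v)"
    define l where "l = least_power p v"
    define T where "T = x ` {..<l}"
    have cyc: "simple_cycle S x l"
      unfolding x_def l_def by (rule orbit_simple_cycle[OF S p v])
    then have inj: "inj_on x {..<l}" and T: "T \<subseteq> S" "card T = l"
      by (auto simp: simple_cycle_def T_def card_image)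
    have weight: "perm_weight R a T p = walk_weight R a x l"
      unfolding T_def by (rule perm_weight_of_simple_cycle[OF a inj]) (simp add: x_def)
    have "perm_weight R a (T \<union> (S - T)) p = perm_weight R a T p \<otimes> perm_weight R a (S - T) p"
      unfolding perm_weight_def using a S T finite_subset by (intro finprod_Un_disjoint) auto
    moreover have "T \<union> (S - T) = S" using T by auto
    ultimately have split: "perm_weight R a S p = walk_weight R a x l \<otimes> perm_weight R a (S - T) p"
      using weight by simp
    have "\<not> l < card S"
      using IH[OF cyc] notin split I.I_r_closed perm_weight_closed[of a, OF a] by auto
    moreover have "l \<le> card S" using T card_mono[OF S T(1)] by simp
    ultimately have "l = card S" by simp
    moreover from this have "T = S" using card_subset_eq[OF S T(1)] T(2) by simp
    ultimately show ?thesis using cyc weight by (simp add: x_def)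
  qed
  obtain v where v: "p v \<noteq> v" using nontrivial by (metis eq_id_iff)
  then have vS: "v \<in> S" using permutes_not_in[OF p] by blast
  \<comment> \<open>A fixed point \<open>u\<close> on the orbit of \<open>v\<close> would make \<open>v\<close> fixed as well.\<close>
  have "p u \<noteq> u"
  proof
    assume fixed: "p u = u"
    obtain i where i: "(p ^^ i) v = u"
      using simple_cycle_image[OF S] spanning[OF vS v] u by (metis imageE)
    then have "(p ^^ i) (p v) = (p ^^ i) v"
      using fixed by (metis funpow_swap1)
    moreover have "inj (p ^^ i)"
      using permutes_inj[OF p] by (rule inj_fn)
    ultimately show False using v by (auto dest: injD)
  qed
  then show "simple_cycle S (\<lambda>i. (p ^^ i) u) (card S)"
    and "perm_weight R a S p = walk_weight R a (\<lambda>i. (p ^^ i) u) (card S)"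
    using spanning[OF u] by auto
qed

text \<open>
  Both permutations are full cycles here, by the preceding lemma; starting their orbits at a point
  where they differ brings them into the form that \<open>spanning_cycles_product\<close> requires.
\<close>

lemma (in cring) perm_weights_orthogonal:
  assumes I: "ideal I R" and a: "\<And>i j. a i j \<in> carrier R" and S: "finite S"
    and p: "p permutes S" "p \<noteq> id" and q: "q permutes S" "q \<noteq> id" and pq: "p \<noteq> q"
    and IH: "\<And>x l. simple_cycle S x l \<Longrightarrow> l < card S \<Longrightarrow> walk_weight R a x l \<in> I"
    and notin: "perm_weight R a S p \<notin> I" "perm_weight R a S q \<notin> I"
  shows "perm_weight R a S p \<otimes> perm_weight R a S q \<in> ideal_prod R I I"
proof -
  obtain u where u: "p u \<noteq> q u" using pq by blast
  then have uS: "u \<in> S" using permutes_not_in[OF p(1)] permutes_not_in[OF q(1)] by metis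
  let ?y = "\<lambda>i. (p ^^ i) u" and ?z = "\<lambda>i. (q ^^ i) u"
  have y: "simple_cycle S ?y (card S)" "perm_weight R a S p = walk_weight R a ?y (card S)"
    using perm_weight_in_ideal_or_spanning[OF I a S p _ notin(1) uS] IH by blast+
  have z: "simple_cycle S ?z (card S)" "perm_weight R a S q = walk_weight R a ?z (card S)"
    using perm_weight_in_ideal_or_spanning[OF I a S q _ notin(2) uS] IH by blast+
  have "?y 0 = ?z 0" "?y 1 \<noteq> ?z 1" using u by simp_all
  from spanning_cycles_product[where a = a, OF I a S y(1) z(1) this] show ?thesis
    unfolding y(2) z(2) using IH by blast
qed

section \<open>Vanishing of the cycle weights\<close>

text \<open>
  The inductive argument over \<open>D\<close>. Among the Leibniz terms of the vertex set of a cycle, the term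
  of the cycle is a summand to which \<open>summand_in_integrally_closed_ideal\<close> applies. The signs
  stay inside the summands \<open>v p\<close>: they affect neither membership in an ideal nor
  orthogonality, so the sign of a cycle never has to be computed.
\<close>

lemma (in cring) cycle_weight_in_integrally_closed_ideal:
  assumes I: "ideal I R" and closed: "integrally_closed R I"
    and a: "\<And>i j. a i j \<in> carrier R"
    and minors: "\<And>S. S \<subseteq> V \<Longrightarrow> principal_minor R a S \<ominus> (\<Otimes>i\<in>S. a i i) \<in> I"
    and x: "simple_cycle V x m"
  shows "walk_weight R a x m \<in> I"
  using x
proof (induction m arbitrary: x rule: less_induct)
  case (less m)
  interpret I: ideal I R by fact
  define S where "S = x ` {..<m}"
  have SV: "S \<subseteq> V" and m: "2 \<le> m" and inj: "inj_on x {..<m}"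
    using less.prems by (auto simp: S_def simple_cycle_def)
  have S: "finite S" "card S = m" using inj by (auto simp: S_def card_image)
  have IH: "walk_weight R a y l \<in> I" if "simple_cycle S y l" "l < card S" for y l
    using less.IH[of l y] that S SV by (auto simp: simple_cycle_def)
  have "simple_cycle S x m"
    using less.prems by (auto simp: simple_cycle_def S_def)
  from simple_cycle_permutation[OF this S_def]
  obtain q where q: "q permutes S" and qx: "\<And>i. i < m \<Longrightarrow> q (x i) = x (Suc i)" by blast
  let ?W = "perm_weight R a S"
  have Wq: "?W q = walk_weight R a x m"
    unfolding S_def by (rule perm_weight_of_simple_cycle[OF a inj qx])
  have "q (x 0) \<noteq> x 0"
    using qx[of 0] m inj_onD[OF inj, of "Suc 0" 0] by auto
  then have qid: "q \<noteq> id" by auto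
  define P where "P = {p. p permutes S \<and> p \<noteq> id}"
  define v where "v p = add_pow R (sign p) (?W p)" for p
  have W: "?W p \<in> carrier R" for p by (rule perm_weight_closed[OF a])
  have v_cases: "v p = ?W p \<or> v p = \<ominus> ?W p" for p
  proof (cases p rule: sign_cases)
    case even then show ?thesis using W add.int_pow_1 by (simp add: v_def)
  next
    case odd then show ?thesis using W add.int_pow_neg[of "?W p" 1] add.int_pow_1 by (simp add: v_def)
  qed
  have v: "v p \<in> carrier R" for p using v_cases[of p] W[of p] by auto
  have v_I: "v p \<in> I \<longleftrightarrow> ?W p \<in> I" for p
    using v_cases[of p] W[of p] I.a_inv_closed[of "?W p"] I.a_inv_closed[of "\<ominus> ?W p"] by auto
  have allperms: "{p. p permutes S} = insert id P"
    by (auto simp: P_def permutes_id)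
  have finP: "finite P"
    using finite_permutations[OF S(1)] unfolding allperms by simp
  have sum: "(\<Oplus>p\<in>P. v p) \<in> I"
  proof -
    define d where "d = (\<Otimes>i\<in>S. a i i)"
    define t where "t = (\<Oplus>p\<in>P. v p)"
    have "principal_minor R a S = (\<Oplus>p\<in>insert id P. v p)"
      by (simp add: principal_minor_def v_def perm_weight_def allperms[symmetric])
    also have "\<dots> = v id \<oplus> t"
      unfolding t_def using finP v by (subst finsum_insert) (auto simp: P_def)
    also have "v id = d"
      using W[of id] add.int_pow_1 by (simp add: v_def perm_weight_def d_def)
    finally have eq: "principal_minor R a S = d \<oplus> t" .
    have car: "d \<in> carrier R" "t \<in> carrier R"
      using a v by (auto simp: d_def t_def intro!: finprod_closed finsum_closed)
    have "d \<oplus> t \<in> carrier R \<and> principal_minor R a S \<ominus> d = t"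
      unfolding eq using car by (auto, algebra)
    then show ?thesis using minors[OF SV] by (simp add: d_def t_def)
  qed
  have "v q \<in> I"
  proof (cases "v q \<in> I")
    case vq: False
    show ?thesis
    proof (rule summand_in_integrally_closed_ideal[OF I closed finP _ v sum])
      show "q \<in> P" using q qid by (simp add: P_def)
    next
      fix p assume p: "p \<in> P" "p \<noteq> q"
      show "v p \<in> I \<or> v p \<otimes> v q \<in> ideal_prod R I I"
      proof (cases "v p \<in> I")
        case False
        interpret I2: ideal "ideal_prod R I I" R by (rule ideal_prod_is_ideal[OF I I])
        have prod: "?W p \<otimes> ?W q \<in> ideal_prod R I I"
          using p q qid False vq v_I
          by (intro perm_weights_orthogonal[OF I a S(1) _ _ _ _ _ IH]) (auto simp: P_def)
        have "v p \<otimes> v q = ?W p \<otimes> ?W q \<or> v p \<otimes> v q = \<ominus> (?W p \<otimes> ?W q)"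
          using v_cases[of p] v_cases[of q] W[of p] W[of q] by (auto simp: l_minus r_minus)
        then show ?thesis using prod I2.a_inv_closed[OF prod] by auto
      qed simp
    qed
  qed
  then show ?case using v_I Wq by simp
qed

section \<open>Matrices over the quotient\<close>

lemma (in ring_hom_cring) hom_principal_minor:
  assumes a: "\<And>i j. a i j \<in> carrier R"
  shows "h (principal_minor R a T) = principal_minor S (\<lambda>i j. h (a i j)) T"
proof -
  have sgn: "h (add_pow R (sign p) x) = add_pow S (sign p) (h x)" if "x \<in> carrier R" for p :: "nat \<Rightarrow> nat" and x
    using that by (cases p rule: sign_cases) (simp_all add: R.add.int_pow_neg S.add.int_pow_neg)
  have prods: "(\<Otimes>\<^bsub>R\<^esub>i\<in>T. a i (p i)) \<in> carrier R" for p
    using a by (auto intro!: R.finprod_closed)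
  define f where "f p = add_pow R (sign p) (\<Otimes>\<^bsub>R\<^esub>i\<in>T. a i (p i))" for p
  have f: "f p \<in> carrier R" for p
    using prods by (simp add: f_def)
  have hf: "h (f p) = add_pow S (sign p) (\<Otimes>\<^bsub>S\<^esub>i\<in>T. h (a i (p i)))" for p
    unfolding f_def sgn[OF prods] using a by (simp add: hom_finprod Pi_def o_def)
  have "h (finsum R f {p. p permutes T}) = finsum S (h \<circ> f) {p. p permutes T}"
    using hom_finsum[of f] f by (simp add: Pi_def o_def)
  then show ?thesis
    unfolding principal_minor_def f_def[symmetric] hf[symmetric] by (simp add: o_def)
qed

lemma principal_minor_cong:
  assumes "\<And>i j. i \<in> T \<Longrightarrow> j \<in> T \<Longrightarrow> a i j = b i j"  and "\<And>i j. b i j \<in> carrier R"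
    and "cring R"
  shows "principal_minor R a T = principal_minor R b T"
proof -
  interpret cring R by fact
  have "(\<Otimes>\<^bsub>R\<^esub>i\<in>T. a i (p i)) = (\<Otimes>\<^bsub>R\<^esub>i\<in>T. b i (p i))" if "p permutes T" for p
    using assms(1,2) permutes_in_image[OF that] by (intro finprod_cong') auto
  moreover have "add_pow R (k::int) (\<Otimes>\<^bsub>R\<^esub>i\<in>T. b i (p i)) \<in> carrier R" for k p
    using assms(2) by (intro add.int_pow_closed finprod_closed) auto
  ultimately show ?thesis
    unfolding principal_minor_def by (intro finsum_cong') auto
qed

lemma (in ideal) quotient_map_eq_zero_iff:
  assumes "x \<in> carrier R"
  shows "I +> x = \<zero>\<^bsub>R Quot I\<^esub> \<longleftrightarrow> x \<in> I"
proof -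
  have "\<zero>\<^bsub>R Quot I\<^esub> = I" unfolding FactRing_def by simp
  then show ?thesis using a_rcos_const a_rcos_self[OF assms] by metis
qed

theorem theorem5p1:
  fixes D :: "('a, 'b) ring_scheme" (structure)
    and I :: "'a set"
    and n :: nat
    and A :: "nat \<Rightarrow> nat \<Rightarrow> 'a set"
  assumes "cring D"
    and "ideal I D"
    and "integrally_closed D I"
    and "matrix_over (D Quot I) n A"
    and "principled (D Quot I) n A"
  shows "nullcyclic (D Quot I) n A"
proof -
  interpret cring D by fact
  interpret I: ideal I D by fact
  let ?R = "D Quot I"
  let ?h = "\<lambda>x. I +> x"
  interpret h: ring_hom_cring D ?R ?h
    using I.rcos_ring_hom_cring assms(1) by simp
  \<comment> \<open>The value zero outside the index range makes every value of \<open>a\<close> an element of \<open>D\<close>.\<close>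
  define a where "a i j = (if i \<in> {1..n} \<and> j \<in> {1..n}
    then SOME x. x \<in> carrier D \<and> ?h x = A i j else \<zero>)" for i j
  have lift: "a i j \<in> carrier D \<and> ?h (a i j) = A i j"
    if ij: "i \<in> {1..n}" "j \<in> {1..n}" for i j
  proof -
    have "A i j \<in> carrier ?R" using assms(4) ij by (simp add: matrix_over_def)
    then have "\<exists>x. x \<in> carrier D \<and> ?h x = A i j"
      unfolding FactRing_def A_RCOSETS_def' by auto
    then have "(SOME x. x \<in> carrier D \<and> ?h x = A i j) \<in> carrier D \<and>
      ?h (SOME x. x \<in> carrier D \<and> ?h x = A i j) = A i j"
      by (rule someI_ex)
    then show ?thesis using ij by (simp add: a_def)
  qed
  have a: "a i j \<in> carrier D" for i j
    using lift[of i j] by (cases "i \<in> {1..n} \<and> j \<in> {1..n}") (auto simp: a_def)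
  have kernel: "?h x = \<zero>\<^bsub>?R\<^esub> \<longleftrightarrow> x \<in> I" if "x \<in> carrier D" for x
    by (rule I.quotient_map_eq_zero_iff[OF that])
  have minors: "principal_minor D a S \<ominus> (\<Otimes>i\<in>S. a i i) \<in> I" if S: "S \<subseteq> {1..n}" for S
  proof -
    have car: "principal_minor D a S \<in> carrier D" "(\<Otimes>i\<in>S. a i i) \<in> carrier D"
      using a by (auto simp: principal_minor_def intro!: finsum_closed finprod_closed)
    have "?h (principal_minor D a S) = principal_minor ?R (\<lambda>i j. ?h (a i j)) S"
      by (rule h.hom_principal_minor[OF a])
    also have "\<dots> = principal_minor ?R A S"
      using S lift a
      by (intro principal_minor_cong[symmetric] h.S.cring_axioms) (blast, simp)
    also have "\<dots> = (\<Otimes>\<^bsub>?R\<^esub>i\<in>S. A i i)"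
      using assms(5) S by (simp add: principled_def)
    also have "\<dots> = (\<Otimes>\<^bsub>?R\<^esub>i\<in>S. ?h (a i i))"
      using S lift a by (intro h.S.finprod_cong') auto
    also have "\<dots> = ?h (\<Otimes>i\<in>S. a i i)"
      using a by (subst h.hom_finprod) (auto simp: o_def)
    finally have "?h (principal_minor D a S \<ominus> (\<Otimes>i\<in>S. a i i)) = \<zero>\<^bsub>?R\<^esub>"
      using car by (simp add: a_minus_def h.S.r_neg)
    then show ?thesis using kernel car by simp
  qed
  show ?thesis
    unfolding nullcyclic_def
  proof (intro allI impI)
    fix C assume C: "nontrivial_cycle n C"
    define m where "m = length C"
    \<comment> \<open>Reading the tuple modulo its length closes it up.\<close>
    define x where "x i = C ! (i mod m)" for i
    have m: "2 \<le> m" and dist: "distinct C" and entries: "set C \<subseteq> {1..n}"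
      using C by (auto simp: nontrivial_cycle_def is_cycle_def m_def)
    have xn: "x i \<in> {1..n}" for i
    proof -
      have "i mod m < length C" using m unfolding m_def by (intro mod_less_divisor) linarith
      from nth_mem[OF this] show ?thesis using entries by (auto simp: x_def)
    qed
    have "simple_cycle {1..n} x m"
      unfolding simple_cycle_def
    proof (intro conjI)
      show "inj_on x {..<m}"
        using dist by (auto simp: x_def m_def inj_on_def nth_eq_iff_index_eq)
      show "x ` {..<m} \<subseteq> {1..n}" using xn by blast
      show "x m = x 0" by (simp add: x_def)
    qed (rule m)
    then have w: "walk_weight D a x m \<in> I"
      using cycle_weight_in_integrally_closed_ideal[where a = a, OF assms(2,3) a] minors by blast
    have "cycle_weight ?R A C = (\<Otimes>\<^bsub>?R\<^esub>i\<in>{..<m}. ?h (a (x i) (x (Suc i))))"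
      unfolding cycle_weight_def m_def[symmetric]
    proof (rule h.S.finprod_cong')
      fix i assume "i \<in> {..<m}"
      moreover have "?h (a (x i) (x (Suc i))) = A (x i) (x (Suc i))"
        using lift[OF xn xn] by blast
      ultimately show "A (C ! i) (C ! (Suc i mod m)) = ?h (a (x i) (x (Suc i)))"
        by (simp add: x_def)
    qed (use a in auto)
    also have "\<dots> = ?h (walk_weight D a x m)"
      unfolding walk_weight_def using a by (subst h.hom_finprod) (auto simp: o_def)
    finally show "cycle_weight ?R A C = \<zero>\<^bsub>?R\<^esub>"
      using w kernel I.Icarr by simp
  qed
qed

end
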